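(* Let $G$ be a regular graph with $n$ vertices, adjacency matrix $A$ and adjacency eigenvalues $\lambda_1 \geq \lambda_2 \geq \cdots \geq \lambda_n$. Let $t$ be a positive integer and let $p \in \mathbb{R}_t[x]$, with parameters $W(p) := \max_{u \in V}\{(p(A))_{uu}\}$ and $\lambda(p) := \min_{i \in [2,n]}\{p(\lambda_i)\}$, and assume $p(\lambda_1) > \lambda(p)$. Then \[ \chi_t(G) \geq \frac{n}{\left\lfloor n\,\frac{W(p) - \lambda(p)}{p(\lambda_1) - \lambda(p)}\right\rfloor}. \]
   Context: Graphs are finite and simple. $\mathbb{R}_t[x]$ denotes the set of real polynomials of degree at most $t$. A distance-$t$ coloring of $G$ is a vertex coloring in which any two distinct vertices at (geodesic) distance at most $t$ receive distinct colors; $\chi_t(G)$, the distance-$t$ chromatic number, is the minimum number of colors in such a coloring (equivalently, the chromatic number of the $t$-th power $G^t$, in which two distinct vertices are adjacent iff their distance in $G$ is at most $t$). *)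

theory Defs
  imports
    "Graph_Theory.Shortest_Path"
    "Jordan_Normal_Form.Char_Poly"
begin

text \<open>
  A finite simple graph is a digraph satisfying the locale \<open>graph\<close> of Graph_Theory: finite,
  loop-free, without parallel arcs, and symmetric, so that an undirected edge is a pair of
  opposite arcs. In particular the out-degree of a vertex is its degree.
\<close>

definition regular_graph :: "('a, 'b) pre_digraph \<Rightarrow> bool" where
  "regular_graph G \<longleftrightarrow> graph G \<and> (\<exists>d. \<forall>v \<in> verts G. out_degree G v = d)"

text \<open>
  Geodesic distance: the weighted distance \<open>\<mu>\<close> of Graph_Theory with unit weights; it is \<open>\<infinity>\<close>
  for vertices in different components.
\<close>

definition geodist :: "('a, 'b) pre_digraph \<Rightarrow> 'a \<Rightarrow> 'a \<Rightarrow> ereal" where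
  "geodist G u v = wf_digraph.\<mu> G (\<lambda>_. 1) u v"

definition distance_coloring :: "('a, 'b) pre_digraph \<Rightarrow> nat \<Rightarrow> ('a \<Rightarrow> 'c) \<Rightarrow> bool" where
  "distance_coloring G t c \<longleftrightarrow>
     (\<forall>u \<in> verts G. \<forall>v \<in> verts G. u \<noteq> v \<and> geodist G u v \<le> ereal (real t) \<longrightarrow> c u \<noteq> c v)"

definition distance_chromatic_number :: "('a, 'b) pre_digraph \<Rightarrow> nat \<Rightarrow> nat" where
  "distance_chromatic_number G t =
     (LEAST k. \<exists>c :: 'a \<Rightarrow> nat. distance_coloring G t c \<and> card (c ` verts G) = k)"

text \<open>
  Matrix rows and columns are numbered from 0, so the adjacency matrix depends on an
  enumeration \<open>vs\<close> of the vertices (a list that is distinct with \<open>set vs = verts G\<close>);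
  index \<open>i\<close> stands for the vertex \<open>vs ! i\<close>.
\<close>

definition adjacency_matrix :: "('a, 'b) pre_digraph \<Rightarrow> 'a list \<Rightarrow> real mat" where
  "adjacency_matrix G vs =
     mat (length vs) (length vs) (\<lambda>(i, j). if vs ! i \<rightarrow>\<^bsub>G\<^esub> vs ! j then 1 else 0)"

text \<open>
  The \<open>i\<close>-th largest real eigenvalue, counted from 1 and with algebraic multiplicity. For a
  symmetric \<open>n \<times> n\<close> matrix all \<open>n\<close> eigenvalues are real, so \<open>i\<close> ranges over \<open>{1..n}\<close>.
\<close>

definition eigenvalue_desc :: "real mat \<Rightarrow> nat \<Rightarrow> real" where
  "eigenvalue_desc A i = rev (sorted_list_of_multiset (proots (char_poly A))) ! (i - 1)"

text \<open>The matrix \<open>p(A)\<close>, for square \<open>A\<close>.\<close>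

definition poly_mat :: "'a :: comm_ring_1 poly \<Rightarrow> 'a mat \<Rightarrow> 'a mat" where
  "poly_mat p A = mat (dim_row A) (dim_row A)
     (\<lambda>(i, j). \<Sum>k \<le> degree p. coeff p k * (A ^\<^sub>m k) $$ (i, j))"

definition W_param :: "real mat \<Rightarrow> real poly \<Rightarrow> real" where
  "W_param A p = Max ((\<lambda>i. poly_mat p A $$ (i, i)) ` {..<dim_row A})"

text \<open>
  The minimum over \<open>i \<in> [2, n]\<close>; only meaningful for \<open>n \<ge> 2\<close>, as the value of \<open>Min {}\<close> is
  unspecified.
\<close>

definition lambda_param :: "real mat \<Rightarrow> real poly \<Rightarrow> real" where
  "lambda_param A p = Min ((\<lambda>i. poly p (eigenvalue_desc A i)) ` {2..dim_row A})"

end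

theory Submission
  imports Defs "Jordan_Normal_Form.Schur_Decomposition" "HOL-Analysis.Convex"
begin

text \<open>
  A colour class \<open>S\<close> of a distance-\<open>t\<close> colouring has vanishing off-diagonal entries in \<open>p(A)\<close>, since
  \<open>degree p \<le> t\<close> and entries of \<open>A\<^sup>k\<close> count walks of length \<open>k\<close>. Hence the quadratic form of \<open>p(A)\<close> at
  the indicator vector of \<open>S\<close> is at most \<open>W(p) |S|\<close>. In an orthonormal eigenbasis of \<open>A\<close>, the all-ones
  vector lies in the eigenspace of the degree, which is \<open>\<lambda>\<^sub>1\<close>; the indicator vector therefore has
  squared norm at least \<open>|S|\<^sup>2 / n\<close> in that eigenspace, and the quadratic form is at least
  \<open>\<lambda>(p) |S| + (p(\<lambda>\<^sub>1) - \<lambda>(p)) |S|\<^sup>2 / n\<close>. So every colour class has at most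
  \<open>n (W(p) - \<lambda>(p)) / (p(\<lambda>\<^sub>1) - \<lambda>(p))\<close> vertices.
\<close>

section \<open>Orthogonal diagonalization of real symmetric matrices\<close>

text \<open>Over the complex numbers an eigenvalue \<open>c\<close> exists by the fundamental
  theorem of algebra. Symmetry makes the Hermitian form of \<open>A\<close> at its eigenvector real,
  so \<open>c\<close> is real and already a root of the real characteristic polynomial.\<close>

lemma real_symmetric_eigenvalue:
  fixes A :: "real mat"
  assumes A: "A \<in> carrier_mat n n" and n: "n > 0"
    and sym: "\<And>i j. i < n \<Longrightarrow> j < n \<Longrightarrow> A $$ (i, j) = A $$ (j, i)"
  shows "\<exists>e. eigenvalue A e"
proof -
  let ?C = "map_mat complex_of_real A"
  have C: "?C \<in> carrier_mat n n" using A by simp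
  have "degree (char_poly ?C) = n" using degree_monic_char_poly[OF C] by blast
  with n have "\<not> constant (poly (char_poly ?C))" by (simp add: constant_degree)
  from fundamental_theorem_of_algebra[OF this]
  obtain c where c: "poly (char_poly ?C) c = 0" by blast
  then have "eigenvalue ?C c" using eigenvalue_root_char_poly[OF C] by blast
  then obtain v where v: "v \<in> carrier_vec n" "v \<noteq> 0\<^sub>v n" "?C *\<^sub>v v = c \<cdot>\<^sub>v v"
    using C by (auto simp: eigenvalue_def eigenvector_def)
  have Cv: "(\<Sum>j<n. A $$ (i, j) * v $ j) = c * v $ i" if "i < n" for i
    using arg_cong[OF v(3), of "\<lambda>w. w $ i"] that A v(1)
    by (simp add: scalar_prod_def lessThan_atLeast0)
  \<comment> \<open>\<open>S\<close> is the Hermitian form of \<open>A\<close> at \<open>v\<close>.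
    It equals \<open>c\<close> times the squared norm of \<open>v\<close>, while conjugating it and
    swapping the two summations gives \<open>S\<close> back.\<close>
  define S where "S = (\<Sum>i<n. \<Sum>j<n. A $$ (i, j) * v $ j * cnj (v $ i))"
  have "S = (\<Sum>i<n. c * (v $ i * cnj (v $ i)))"
    unfolding S_def sum_distrib_right[symmetric] by (simp add: Cv mult.assoc)
  also have "\<dots> = c * of_real (\<Sum>i<n. (cmod (v $ i))\<^sup>2)"
    by (simp only: sum_distrib_left complex_norm_square of_real_sum)
  finally have S: "S = c * of_real (\<Sum>i<n. (cmod (v $ i))\<^sup>2)" .
  have "cnj S = (\<Sum>i<n. \<Sum>j<n. A $$ (i, j) * cnj (v $ j) * v $ i)"
    by (simp add: S_def)
  also have "\<dots> = (\<Sum>j<n. \<Sum>i<n. A $$ (i, j) * cnj (v $ j) * v $ i)"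
    by (rule sum.swap)
  also have "\<dots> = S"
    unfolding S_def by (intro sum.cong refl) (use sym in auto)
  finally have "cnj S = S" .
  obtain k where k: "k < n" "v $ k \<noteq> 0" using v(1,2) by (metis eq_vecI carrier_vecD index_zero_vec)
  have "(\<Sum>i<n. (cmod (v $ i))\<^sup>2) > 0"
    by (rule sum_pos2[of _ k]) (use k in auto)
  then have "complex_of_real (\<Sum>i<n. (cmod (v $ i))\<^sup>2) \<noteq> 0"
    unfolding of_real_eq_0_iff by linarith
  with \<open>cnj S = S\<close> have "cnj c = c"
    unfolding S complex_cnj_mult complex_cnj_complex_of_real by (metis mult_right_cancel)
  then have "c = of_real (Re c)" by (simp add: complex_eq_iff)
  \<comment> \<open>The complex characteristic polynomial is the image of the real one, so a real
    root of the former is a root of the latter.\<close>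
  with c have "poly (map_poly of_real (char_poly A)) (complex_of_real (Re c)) = 0"
    by (metis of_real_hom.char_poly_hom[OF A])
  then have "poly (char_poly A) (Re c) = 0" by simp
  then show ?thesis using eigenvalue_root_char_poly[OF A] by blast
qed

text \<open>Complete \<open>v\<close> to a basis and apply Gram-Schmidt, which keeps the first
  vector; normalising the results gives the columns. The scalar \<open>k\<close> is the normalising
  factor of \<open>v\<close>. This supplies the deflation step of the spectral theorem.\<close>

lemma orthogonal_mat_first_column:
  fixes v :: "real vec"
  assumes v: "v \<in> carrier_vec n" and v1: "v \<noteq> 0\<^sub>v n"
  shows "\<exists>W k. W \<in> carrier_mat n n \<and> W\<^sup>T * W = 1\<^sub>m n \<and> col W 0 = k \<cdot>\<^sub>v v"
proof -
  interpret cof_vec_space n "TYPE(real)" .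
  define ws where "ws = gram_schmidt n (basis_completion v)"
  note b = basis_completion[OF v v1]
  note g = gram_schmidt_result[OF b(2,4) b(5) ws_def]
  have len: "length ws = n" using g b by simp
  have hd: "hd ws = v" unfolding ws_def
    unfolding basis_completion_def Let_def by (rule gram_schmidt_hd[OF v])
  define r where "r j = 1 / sqrt (ws ! j \<bullet> ws ! j)" for j
  define W where "W = mat n n (\<lambda>(i, j). r j * ws ! j $ i)"
  have W: "W \<in> carrier_mat n n" by (simp add: W_def)
  have wsc: "ws ! j \<in> carrier_vec n" if "j < n" for j using g(3) len that by auto
  \<comment> \<open>\<open>corthogonal\<close> refers to the conjugated scalar product, which over
    the reals is the plain one.\<close>
  have conj: "conjugate u = u" for u :: "real vec" by (rule eq_vecI) (auto simp: conjugate_real_def)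
  have orth: "ws ! i \<bullet> ws ! j = 0 \<longleftrightarrow> i \<noteq> j" if "i < n" "j < n" for i j
    using corthogonalD[OF g(2)] that len by (simp add: conj)
  have nonneg: "ws ! j \<bullet> ws ! j \<ge> 0" for j
    by (auto simp: scalar_prod_def intro!: sum_nonneg)
  have col: "col W j = r j \<cdot>\<^sub>v ws ! j" if "j < n" for j
    by (rule eq_vecI) (use that wsc[OF that] in \<open>auto simp: W_def\<close>)
  have "W\<^sup>T * W = 1\<^sub>m n"
  proof (rule eq_matI)
    fix i j assume ij: "i < dim_row (1\<^sub>m n)" "j < dim_col (1\<^sub>m n)"
    then have "(W\<^sup>T * W) $$ (i, j) = r i * r j * (ws ! i \<bullet> ws ! j)"
      using W wsc[of i] wsc[of j] by (simp add: col)
    also have "\<dots> = 1\<^sub>m n $$ (i, j)"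
      using ij orth[of i j] nonneg[of i] by (auto simp: r_def)
    finally show "(W\<^sup>T * W) $$ (i, j) = 1\<^sub>m n $$ (i, j)" .
  qed (use W in auto)
  moreover have "n > 0" using v v1 by (cases n) auto
  moreover have "ws ! 0 = v" using hd len \<open>n > 0\<close> by (metis hd_conv_nth length_0_conv not_gr_zero)
  ultimately show ?thesis using W col[of 0] by auto
qed

text \<open>Induction by deflation: conjugation by an orthogonal matrix whose first column is an
  eigenvector clears the first column off the diagonal, hence by symmetry the first row too. The
  remaining symmetric block is diagonalized by the induction hypothesis.\<close>

lemma real_spectral_theorem:
  fixes A :: "real mat"
  assumes "A \<in> carrier_mat n n" and "A\<^sup>T = A"
  shows "\<exists>U D. U \<in> carrier_mat n n \<and> D \<in> carrier_mat n n \<and> U\<^sup>T * U = 1\<^sub>m n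
    \<and> diagonal_mat D \<and> A = U * D * U\<^sup>T"
  using assms
proof (induction n arbitrary: A)
  case 0
  then show ?case
    by (intro exI[of _ "1\<^sub>m 0"]) (auto simp: diagonal_mat_def intro!: eq_matI)
next
  case (Suc n)
  note A = Suc.prems(1)
  have "A $$ (i, j) = A $$ (j, i)" if "i < Suc n" "j < Suc n" for i j
    using Suc.prems that by (metis carrier_matD index_transpose_mat(1))
  with real_symmetric_eigenvalue[OF A] obtain e v where
    v: "v \<in> carrier_vec (Suc n)" "v \<noteq> 0\<^sub>v (Suc n)" "A *\<^sub>v v = e \<cdot>\<^sub>v v"
    using A by (auto simp: eigenvalue_def eigenvector_def)
  obtain W k where W: "W \<in> carrier_mat (Suc n) (Suc n)" and WW: "W\<^sup>T * W = 1\<^sub>m (Suc n)"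
    and col0: "col W 0 = k \<cdot>\<^sub>v v"
    using orthogonal_mat_first_column[OF v(1,2)] by blast
  have WT: "W\<^sup>T \<in> carrier_mat (Suc n) (Suc n)" using W by simp
  have WW': "W * W\<^sup>T = 1\<^sub>m (Suc n)" by (rule mat_mult_left_right_inverse[OF WT W WW])
  define B where "B = W\<^sup>T * A * W"
  have B: "B \<in> carrier_mat (Suc n) (Suc n)" using W A by (simp add: B_def)
  have "B\<^sup>T = W\<^sup>T * (A\<^sup>T * W\<^sup>T\<^sup>T)" unfolding B_def
    using W WT A by (simp add: transpose_mult[of _ "Suc n" "Suc n" _ "Suc n"])
  also have "\<dots> = B" unfolding B_def using W WT A Suc.prems(2) by (simp add: assoc_mult_mat[of _ "Suc n" "Suc n" _ "Suc n" _ "Suc n"])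
  finally have BT: "B\<^sup>T = B" .
  have A_eq: "A = W * B * W\<^sup>T"
  proof -
    have "W * B * W\<^sup>T = (W * W\<^sup>T) * A * (W * W\<^sup>T)"
      unfolding B_def using W WT A by (simp add: assoc_mult_mat[of _ "Suc n" "Suc n" _ "Suc n" _ "Suc n"])
    then show ?thesis using A by (simp add: WW')
  qed
  \<comment> \<open>Column 0 of \<open>W\<close> is a multiple of \<open>v\<close>, hence mapped by
    \<open>A\<close> to \<open>e\<close> times itself; orthonormality of the columns then leaves
    only the corner entry.\<close>
  have B0: "B $$ (i, 0) = (if i = 0 then e else 0)" if i: "i < Suc n" for i
  proof -
    have "A *\<^sub>v col W 0 = e \<cdot>\<^sub>v col W 0"
      using v A by (simp add: col0 mult_mat_vec smult_smult_assoc mult.commute)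
    then have "col (A * W) 0 = e \<cdot>\<^sub>v col W 0"
      using col_mult2[OF A W, of 0] by simp
    moreover have "B $$ (i, 0) = row (W\<^sup>T) i \<bullet> col (A * W) 0"
      using i A W by (simp add: B_def assoc_mult_mat[of _ "Suc n" "Suc n" _ "Suc n" _ "Suc n"])
    moreover have "row (W\<^sup>T) i \<bullet> col W 0 = 1\<^sub>m (Suc n) $$ (i, 0)"
      using i W by (simp flip: WW)
    ultimately show ?thesis using i W by simp
  qed
  define A' where "A' = mat n n (\<lambda>(i, j). B $$ (Suc i, Suc j))"
  define E where "E = mat 1 1 (\<lambda>_. e)"
  have Bsym: "B $$ (i, j) = B $$ (j, i)" if "i < Suc n" "j < Suc n" for i j
    using BT B that by (metis carrier_matD index_transpose_mat(1))
  have B_eq: "B = four_block_mat E (0\<^sub>m 1 n) (0\<^sub>m n 1) A'"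
  proof (rule eq_matI)
    fix i j assume "i < dim_row (four_block_mat E (0\<^sub>m 1 n) (0\<^sub>m n 1) A')"
      "j < dim_col (four_block_mat E (0\<^sub>m 1 n) (0\<^sub>m n 1) A')"
    then have "i < Suc n" "j < Suc n" by (auto simp: E_def A'_def)
    then show "B $$ (i, j) = four_block_mat E (0\<^sub>m 1 n) (0\<^sub>m n 1) A' $$ (i, j)"
      using B0[of i] B0[of j] Bsym[of i j] by (auto simp: E_def A'_def)
  qed (use B in \<open>auto simp: E_def A'_def\<close>)
  have A': "A' \<in> carrier_mat n n" by (simp add: A'_def)
  have "A'\<^sup>T = A'" by (rule eq_matI) (auto simp: A'_def Bsym)
  from Suc.IH[OF A' this] obtain U D where U: "U \<in> carrier_mat n n"
    and D: "D \<in> carrier_mat n n" "diagonal_mat D"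
    and UU: "U\<^sup>T * U = 1\<^sub>m n" and A'_eq: "A' = U * D * U\<^sup>T" by blast
  \<comment> \<open>The diagonalization of the smaller block, extended by a 1 in the corner; the
    orthogonal matrix sought is \<open>W * V\<close>.\<close>
  define V where "V = four_block_mat (1\<^sub>m 1) (0\<^sub>m 1 n) (0\<^sub>m n 1) U"
  define F where "F = four_block_mat E (0\<^sub>m 1 n) (0\<^sub>m n 1) D"
  have E: "E \<in> carrier_mat 1 1" by (simp add: E_def)
  have V: "V \<in> carrier_mat (Suc n) (Suc n)" using U by (auto simp: V_def)
  have F: "F \<in> carrier_mat (Suc n) (Suc n)" using D E by (auto simp: F_def)
  have VT: "V\<^sup>T = four_block_mat (1\<^sub>m 1) (0\<^sub>m 1 n) (0\<^sub>m n 1) (U\<^sup>T)"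
    unfolding V_def using U by (subst transpose_four_block_mat[of _ 1 1 _ n _ n]) auto
  have VV: "V\<^sup>T * V = 1\<^sub>m (Suc n)"
    unfolding VT unfolding V_def using U UU
    by (subst mult_four_block_mat[of _ 1 1 _ n _ n _ _ 1 _ n]) (auto intro!: eq_matI)
  have VFV: "V * F * V\<^sup>T = B"
    unfolding VT unfolding V_def F_def B_eq A'_eq using U D E
    by (simp add: mult_four_block_mat[of _ 1 1 _ n _ n _ _ 1 _ n])
  have VTc: "V\<^sup>T \<in> carrier_mat (Suc n) (Suc n)" using V by simp
  have "(W * V)\<^sup>T = V\<^sup>T * W\<^sup>T" by (rule transpose_mult[OF W V])
  moreover have "V\<^sup>T * W\<^sup>T * (W * V) = V\<^sup>T * (W\<^sup>T * W) * V"
    using V W VTc WT by (simp add: assoc_mult_mat[of _ "Suc n" "Suc n" _ "Suc n" _ "Suc n"])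
  moreover have "W * V * F * (V\<^sup>T * W\<^sup>T) = W * (V * F * V\<^sup>T) * W\<^sup>T"
    using V W F VTc WT by (simp add: assoc_mult_mat[of _ "Suc n" "Suc n" _ "Suc n" _ "Suc n"])
  moreover have "diagonal_mat F" using D E by (auto simp: diagonal_mat_def F_def)
  ultimately show ?case
    using W V F VTc by (intro exI[of _ "W * V"] exI[of _ F]) (simp add: WW VV VFV A_eq)
qed

lemma proots_prod_list_linear:
  "proots (\<Prod>a\<leftarrow>as. [:- a, 1:]) = mset (as :: 'a :: idom list)"
proof (induction as)
  case (Cons a as)
  have "proots ([:- a, 1:] * (\<Prod>a\<leftarrow>as. [:- a, 1:])) = proots [:- a, 1:] + proots (\<Prod>a\<leftarrow>as. [:- a, 1:])"
    by (rule proots_mult) (auto simp: prod_list_zero_iff)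
  with Cons show ?case by (simp only: list.map prod_list.Cons proots_linear_factor) simp
qed simp

text \<open>The spectral theorem in coordinates: \<open>u i l\<close> is entry \<open>i\<close> of
  the \<open>l\<close>-th unit eigenvector and \<open>d l\<close> its eigenvalue. Similarity to the
  diagonal matrix shows that the \<open>d l\<close> exhaust the roots with multiplicity, which ties
  them to \<open>eigenvalue_desc\<close>.\<close>

lemma real_symmetric_eigenbasis:
  fixes A :: "real mat"
  assumes A: "A \<in> carrier_mat n n" and sym: "A\<^sup>T = A"
  obtains u :: "nat \<Rightarrow> nat \<Rightarrow> real" and d :: "nat \<Rightarrow> real" where
    "\<And>i j. i < n \<Longrightarrow> j < n \<Longrightarrow> (\<Sum>l<n. u i l * u j l) = of_bool (i = j)"
    "\<And>k l. k < n \<Longrightarrow> l < n \<Longrightarrow> (\<Sum>i<n. u i k * u i l) = of_bool (k = l)"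
    "\<And>i l. i < n \<Longrightarrow> l < n \<Longrightarrow> (\<Sum>j<n. A $$ (i, j) * u j l) = d l * u i l"
    "proots (char_poly A) = mset (map d [0..<n])"
proof -
  obtain U D where U: "U \<in> carrier_mat n n" and D: "D \<in> carrier_mat n n" "diagonal_mat D"
    and UU: "U\<^sup>T * U = 1\<^sub>m n" and A_eq: "A = U * D * U\<^sup>T"
    using real_spectral_theorem[OF A sym] by blast
  have UT: "U\<^sup>T \<in> carrier_mat n n" using U by simp
  have UU': "U * U\<^sup>T = 1\<^sub>m n" by (rule mat_mult_left_right_inverse[OF UT U UU])
  have "(\<Sum>l<n. U $$ (i, l) * U $$ (j, l)) = of_bool (i = j)" if "i < n" "j < n" for i j
    using arg_cong[OF UU', of "\<lambda>M. M $$ (i, j)"] that U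
    by (simp add: scalar_prod_def lessThan_atLeast0)
  moreover have "(\<Sum>i<n. U $$ (i, k) * U $$ (i, l)) = of_bool (k = l)" if "k < n" "l < n" for k l
    using arg_cong[OF UU, of "\<lambda>M. M $$ (k, l)"] that U
    by (simp add: scalar_prod_def lessThan_atLeast0)
  moreover have "(\<Sum>j<n. A $$ (i, j) * U $$ (j, l)) = D $$ (l, l) * U $$ (i, l)"
    if "i < n" "l < n" for i l
  proof -
    have "A * U = U * D * (U\<^sup>T * U)"
      unfolding A_eq using U D UT by (simp add: assoc_mult_mat[of _ n n _ n _ n])
    also have "\<dots> = U * D" using U D by (simp add: UU)
    finally have "(A * U) $$ (i, l) = (U * D) $$ (i, l)" by simp
    then have "(\<Sum>j<n. A $$ (i, j) * U $$ (j, l)) = (\<Sum>j<n. U $$ (i, j) * D $$ (j, l))"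
      using that U D A by (simp add: scalar_prod_def lessThan_atLeast0)
    also have "\<dots> = (\<Sum>j<n. if j = l then U $$ (i, l) * D $$ (l, l) else 0)"
      by (rule sum.cong) (use D that in \<open>auto simp: diagonal_mat_def\<close>)
    also have "\<dots> = D $$ (l, l) * U $$ (i, l)" using that by simp
    finally show ?thesis .
  qed
  moreover have "proots (char_poly A) = mset (map (\<lambda>l. D $$ (l, l)) [0..<n])"
  proof -
    have "similar_mat_wit A D U (U\<^sup>T)"
      by (rule similar_mat_witI[OF UU' UU A_eq A D(1) U UT])
    then have "char_poly A = char_poly D"
      by (intro char_poly_similar) (auto simp: similar_mat_def)
    also have "\<dots> = (\<Prod>a\<leftarrow>diag_mat D. [:- a, 1:])"
      by (rule char_poly_upper_triangular[OF D(1)]) (use D in \<open>auto simp: upper_triangular_def diagonal_mat_def\<close>)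
    also have "proots \<dots> = mset (diag_mat D)"
      by (rule proots_prod_list_linear)
    finally show ?thesis using D by (simp add: diag_mat_def)
  qed
  ultimately show thesis by (rule that)
qed

text \<open>Each power of \<open>A\<close> has the same eigenvectors, with eigenvalues raised to
  that power; linearity then gives \<open>p\<close>. Orthonormality of the rows is the case of power
  0.\<close>

lemma poly_mat_eigenbasis:
  fixes A :: "real mat"
  assumes A: "A \<in> carrier_mat n n" and sym: "A\<^sup>T = A"
    and row_orth: "\<And>i j. i < n \<Longrightarrow> j < n \<Longrightarrow> (\<Sum>l<n. u i l * u j l) = of_bool (i = j)"
    and eigen: "\<And>i l. i < n \<Longrightarrow> l < n \<Longrightarrow> (\<Sum>j<n. A $$ (i, j) * u j l) = d l * u i l"
    and i: "i < n" and j: "j < n"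
  shows "poly_mat p A $$ (i, j) = (\<Sum>l<n. poly p (d l) * (u i l * u j l))"
proof -
  have pow: "(A ^\<^sub>m k) $$ (i, j) = (\<Sum>l<n. d l ^ k * (u i l * u j l))" if j: "j < n" for k j
    using j
  proof (induction k arbitrary: j)
    case 0
    then show ?case using A i row_orth[of i j] by simp
  next
    case (Suc k)
    have Ak: "A ^\<^sub>m k \<in> carrier_mat n n" using A by simp
    have A_sym: "A $$ (m, j) = A $$ (j, m)" if "m < n" for m
      using sym A that Suc.prems by (metis carrier_matD index_transpose_mat(1))
    have "(A ^\<^sub>m Suc k) $$ (i, j) = (\<Sum>m<n. (A ^\<^sub>m k) $$ (i, m) * A $$ (m, j))"
      using i Suc.prems A Ak by (simp add: scalar_prod_def lessThan_atLeast0)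
    also have "\<dots> = (\<Sum>m<n. \<Sum>l<n. d l ^ k * (u i l * u m l) * A $$ (m, j))"
      by (rule sum.cong) (simp_all add: Suc.IH sum_distrib_right)
    also have "\<dots> = (\<Sum>l<n. \<Sum>m<n. d l ^ k * (u i l * u m l) * A $$ (m, j))" by (rule sum.swap)
    also have "\<dots> = (\<Sum>l<n. d l ^ k * u i l * (\<Sum>m<n. A $$ (j, m) * u m l))"
      unfolding sum_distrib_left by (intro sum.cong refl) (simp add: A_sym)
    also have "\<dots> = (\<Sum>l<n. d l ^ Suc k * (u i l * u j l))"
      by (rule sum.cong) (simp_all add: eigen Suc.prems)
    finally show ?case .
  qed
  have "poly_mat p A $$ (i, j) = (\<Sum>k\<le>degree p. coeff p k * (A ^\<^sub>m k) $$ (i, j))"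
    using i j A by (simp add: poly_mat_def)
  also have "\<dots> = (\<Sum>k\<le>degree p. \<Sum>l<n. coeff p k * d l ^ k * (u i l * u j l))"
    by (simp add: pow[OF j] sum_distrib_left mult.assoc)
  also have "\<dots> = (\<Sum>l<n. \<Sum>k\<le>degree p. coeff p k * d l ^ k * (u i l * u j l))" by (rule sum.swap)
  also have "\<dots> = (\<Sum>l<n. poly p (d l) * (u i l * u j l))"
    by (simp add: poly_altdef sum_distrib_right)
  finally show ?thesis .
qed

section \<open>Largest eigenvalue and the ordered spectrum\<close>

text \<open>Read the eigenvalue equation at a coordinate where \<open>x\<close> is largest in
  absolute value: the triangle inequality bounds its right side by \<open>r\<close> times that
  maximum.\<close>

lemma eigenvalue_le_row_sum:
  fixes A :: "real mat"
  assumes nonneg: "\<And>i j. i < n \<Longrightarrow> j < n \<Longrightarrow> A $$ (i, j) \<ge> 0"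
    and row_sum: "\<And>i. i < n \<Longrightarrow> (\<Sum>j<n. A $$ (i, j)) = r"
    and eigen: "\<And>i. i < n \<Longrightarrow> (\<Sum>j<n. A $$ (i, j) * x j) = e * x i"
    and nonzero: "k < n" "x k \<noteq> 0"
  shows "e \<le> r"
proof -
  define m where "m = Max ((\<lambda>i. \<bar>x i\<bar>) ` {..<n})"
  have le: "\<bar>x i\<bar> \<le> m" if "i < n" for i unfolding m_def by (rule Max_ge) (use that in auto)
  have "m \<in> (\<lambda>i. \<bar>x i\<bar>) ` {..<n}" unfolding m_def by (rule Max_in) (use nonzero in auto)
  then obtain i where i: "i < n" "\<bar>x i\<bar> = m" by auto
  have m: "m > 0" using le[OF nonzero(1)] nonzero(2) by linarith
  have "e * m \<le> \<bar>e * x i\<bar>" using i m by (simp add: abs_mult mult_right_mono)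
  also have "\<dots> = \<bar>\<Sum>j<n. A $$ (i, j) * x j\<bar>" by (simp add: eigen i)
  also have "\<dots> \<le> (\<Sum>j<n. \<bar>A $$ (i, j) * x j\<bar>)" by (rule sum_abs)
  also have "\<dots> \<le> (\<Sum>j<n. A $$ (i, j) * m)"
    by (rule sum_mono) (use i le nonneg in \<open>auto simp: abs_mult intro!: mult_left_mono\<close>)
  also have "\<dots> = r * m" using i by (simp add: row_sum flip: sum_distrib_right)
  finally show ?thesis using m by simp
qed

lemma rev_sort_nth_0:
  fixes xs :: "'a::linorder list"
  assumes "x \<in> set xs" "\<And>y. y \<in> set xs \<Longrightarrow> y \<le> x"
  shows "rev (sort xs) ! 0 = x"
proof -
  obtain i where i: "i < length xs" "sort xs ! i = x"
    using assms(1) by (metis in_set_conv_nth length_sort set_sort)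
  let ?m = "length xs - 1"
  have eq: "rev (sort xs) ! 0 = sort xs ! ?m" using i(1) by (cases xs) (simp_all add: rev_nth del: sort_key_simps)
  have "sort xs ! ?m \<in> set xs" using i(1) nth_mem[of ?m "sort xs"] by simp
  moreover have "x \<le> sort xs ! ?m"
    using sorted_nth_mono[OF sorted_sort, of i ?m xs] i by simp
  ultimately show ?thesis using assms(2) eq by (metis antisym)
qed

text \<open>The head of the descending list is \<open>r\<close>, so an eigenvalue different from
  \<open>r\<close> sits at a later position and takes part in the minimum defining
  \<open>lambda_param\<close>.\<close>

lemma eigenvalue_desc_mset:
  fixes A :: "real mat"
  assumes A: "A \<in> carrier_mat n n" and roots: "proots (char_poly A) = mset (map d [0..<n])"
    and top: "k < n" "d k = r" "\<And>l. l < n \<Longrightarrow> d l \<le> r"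
  shows "eigenvalue_desc A 1 = r"
    and "\<And>l. l < n \<Longrightarrow> d l \<noteq> r \<Longrightarrow> lambda_param A p \<le> poly p (d l)"
proof -
  define es where "es = rev (sort (map d [0..<n]))"
  have es: "eigenvalue_desc A i = es ! (i - 1)" for i
    unfolding eigenvalue_desc_def roots es_def sorted_list_of_multiset_mset ..
  have hd: "es ! 0 = r" unfolding es_def by (rule rev_sort_nth_0) (use top in auto)
  then show "eigenvalue_desc A 1 = r" by (simp add: es)
  show "lambda_param A p \<le> poly p (d l)" if l: "l < n" "d l \<noteq> r" for l
  proof -
    have "d l \<in> set es" using l by (simp add: es_def)
    moreover have "length es = n" by (simp add: es_def)
    ultimately obtain i where i: "i < n" "es ! i = d l" by (metis in_set_conv_nth)
    \<comment> \<open>List positions start at 0 and eigenvalue numbers at 1, so a nonzero position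
      \<open>i\<close> means eigenvalue number \<open>Suc i\<close> in
      \<open>{2..n}\<close>.\<close>
    then have "i \<noteq> 0" using hd l by metis
    then have "poly p (d l) \<in> (\<lambda>i. poly p (eigenvalue_desc A i)) ` {2..dim_row A}"
      using i A by (intro image_eqI[of _ _ "Suc i"]) (auto simp: es)
    then show ?thesis unfolding lambda_param_def by (intro Min_le) auto
  qed
qed

section \<open>The ratio bound\<close>

text \<open>A Hoffman-type ratio bound, for a nonnegative symmetric matrix with constant row sums.
  Independence of \<open>S\<close> is replaced by the vanishing of \<open>p(A)\<close> off the
  diagonal on \<open>S\<close>.\<close>

lemma ratio_bound:
  fixes A :: "real mat"
  assumes A: "A \<in> carrier_mat n n" and sym: "A\<^sup>T = A"
    and nonneg: "\<And>i j. i < n \<Longrightarrow> j < n \<Longrightarrow> A $$ (i, j) \<ge> 0"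
    and row_sum: "\<And>i. i < n \<Longrightarrow> (\<Sum>j<n. A $$ (i, j)) = r"
    and S: "S \<subseteq> {..<n}" "S \<noteq> {}"
    and indep: "\<And>i j. i \<in> S \<Longrightarrow> j \<in> S \<Longrightarrow> i \<noteq> j \<Longrightarrow> poly_mat p A $$ (i, j) = 0"
    and gap: "poly p (eigenvalue_desc A 1) > lambda_param A p"
  shows "real (card S) * (poly p (eigenvalue_desc A 1) - lambda_param A p)
    \<le> real n * (W_param A p - lambda_param A p)"
proof -
  obtain u d where
    row_orth: "\<And>i j. i < n \<Longrightarrow> j < n \<Longrightarrow> (\<Sum>l<n. u i l * u j l) = of_bool (i = j)"
    and col_orth: "\<And>k l. k < n \<Longrightarrow> l < n \<Longrightarrow> (\<Sum>i<n. u i k * u i l) = of_bool (k = l)"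
    and eigen: "\<And>i l. i < n \<Longrightarrow> l < n \<Longrightarrow> (\<Sum>j<n. A $$ (i, j) * u j l) = d l * u i l"
    and roots: "proots (char_poly A) = mset (map d [0..<n])"
    by (rule real_symmetric_eigenbasis[OF A sym]) (rule that)
  have A_sym: "A $$ (i, j) = A $$ (j, i)" if "i < n" "j < n" for i j
    using sym A that by (metis carrier_matD index_transpose_mat(1))
  have fin: "finite S" and n: "n > 0" using S finite_subset[of S "{..<n}"] by auto
  let ?s = "real (card S)" and ?lam = "lambda_param A p" and ?W = "W_param A p"
  \<comment> \<open>\<open>f\<close> and \<open>g\<close> hold the eigenbasis coordinates of the
    indicator vector of \<open>S\<close> and of the all-ones vector.\<close>
  define f where "f l = (\<Sum>i\<in>S. u i l)" for l
  define g where "g l = (\<Sum>i<n. u i l)" for l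
  \<comment> \<open>Used with weights 1 for inner products (Parseval) and with weights
    \<open>poly p (d l)\<close> for the quadratic form of \<open>p(A)\<close>.\<close>
  have double: "(\<Sum>l<n. c l * ((\<Sum>i\<in>X. u i l) * (\<Sum>j\<in>Y. u j l)))
    = (\<Sum>i\<in>X. \<Sum>j\<in>Y. \<Sum>l<n. c l * (u i l * u j l))" for c X Y
  proof -
    have "(\<Sum>l<n. c l * ((\<Sum>i\<in>X. u i l) * (\<Sum>j\<in>Y. u j l)))
      = (\<Sum>l<n. \<Sum>i\<in>X. \<Sum>j\<in>Y. c l * (u i l * u j l))"
      by (simp only: sum_product) (simp add: sum_distrib_left)
    also have "\<dots> = (\<Sum>i\<in>X. \<Sum>l<n. \<Sum>j\<in>Y. c l * (u i l * u j l))" by (rule sum.swap)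
    also have "\<dots> = (\<Sum>i\<in>X. \<Sum>j\<in>Y. \<Sum>l<n. c l * (u i l * u j l))"
      by (intro sum.cong refl sum.swap)
    finally show ?thesis .
  qed
  have inner: "(\<Sum>l<n. (\<Sum>i\<in>X. u i l) * (\<Sum>j\<in>Y. u j l)) = real (card (X \<inter> Y))"
    if "X \<subseteq> {..<n}" "Y \<subseteq> {..<n}" for X Y
  proof -
    have "(\<Sum>l<n. (\<Sum>i\<in>X. u i l) * (\<Sum>j\<in>Y. u j l)) = (\<Sum>i\<in>X. \<Sum>j\<in>Y. of_bool (i = j))"
      using double[of "\<lambda>_. 1" X Y] that
      by (simp add: subset_iff row_orth cong: sum.cong)
    also have "\<dots> = (\<Sum>i\<in>X. of_bool (i \<in> Y))"
      using that finite_subset[of Y "{..<n}"] by (simp add: of_bool_def)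
    also have "\<dots> = real (card (X \<inter> Y))"
      using that finite_subset[of X "{..<n}"] by (simp add: sum_of_bool_eq Int_def)
    finally show ?thesis .
  qed
  have ff: "(\<Sum>l<n. (f l)\<^sup>2) = ?s" using inner[OF S(1) S(1)] by (simp add: f_def power2_eq_square)
  have gg: "(\<Sum>l<n. (g l)\<^sup>2) = real n"
    using inner[of "{..<n}" "{..<n}"] by (simp add: g_def power2_eq_square)
  have fg: "(\<Sum>l<n. f l * g l) = ?s"
    using inner[of S "{..<n}"] S by (simp add: f_def g_def Int_absorb2)
  \<comment> \<open>The all-ones vector is an eigenvector for \<open>r\<close>, hence orthogonal to
    eigenvectors for other eigenvalues: evaluating one double sum in both orders gives
    \<open>d l * g l = r * g l\<close>.\<close>
  have g_zero: "g l = 0" if l: "l < n" "d l \<noteq> r" for l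
  proof -
    have "d l * g l = (\<Sum>i<n. \<Sum>j<n. A $$ (i, j) * u j l)"
      by (simp add: g_def sum_distrib_left eigen l)
    also have "\<dots> = (\<Sum>j<n. \<Sum>i<n. A $$ (i, j) * u j l)" by (rule sum.swap)
    also have "\<dots> = (\<Sum>j<n. (\<Sum>i<n. A $$ (j, i)) * u j l)"
      unfolding sum_distrib_right by (intro sum.cong refl) (simp add: A_sym)
    also have "\<dots> = r * g l" by (simp add: row_sum g_def sum_distrib_left)
    finally show ?thesis using l by simp
  qed
  obtain k where k: "k < n" "d k = r"
  proof -
    \<comment> \<open>Otherwise every coordinate of the all-ones vector vanishes, although its
      squared norm is \<open>n > 0\<close>.\<close>
    have "\<exists>k<n. d k = r"
    proof (rule ccontr)
      assume "\<not> (\<exists>k<n. d k = r)"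
      then have "(\<Sum>l<n. (g l)\<^sup>2) = 0" using g_zero by (intro sum.neutral) auto
      with gg n show False by simp
    qed
    then show thesis using that by blast
  qed
  have d_le: "d l \<le> r" if l: "l < n" for l
  proof -
    have "(\<Sum>i<n. u i l * u i l) \<noteq> 0" using col_orth[OF l l] by simp
    then obtain i where "i < n" "u i l \<noteq> 0" by (auto elim: sum.not_neutral_contains_not_neutral)
    then show ?thesis
      using eigenvalue_le_row_sum[of n A r "\<lambda>i. u i l" "d l" i] nonneg row_sum eigen[OF _ l] by auto
  qed
  note desc = eigenvalue_desc_mset[OF A roots k d_le]
  \<comment> \<open>\<open>r\<close> may be a multiple eigenvalue, as for disconnected graphs, so
    its whole eigenspace is kept together; \<open>F\<close> is the squared norm of the projection of
    the indicator vector to it.\<close>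
  define L where "L = {l. l < n \<and> d l = r}"
  define F where "F = (\<Sum>l\<in>L. (f l)\<^sup>2)"
  have split: "(\<Sum>l<n. h l) = (\<Sum>l\<in>L. h l) + (\<Sum>l\<in>{..<n} - L. h l)" for h :: "nat \<Rightarrow> real"
    by (subst add.commute, rule sum.subset_diff) (auto simp: L_def)
  \<comment> \<open>Cauchy-Schwarz on \<open>L\<close>, where all of \<open>g\<close> is
    supported.\<close>
  have "?s\<^sup>2 \<le> F * real n"
  proof -
    have "?s = (\<Sum>l\<in>L. f l * g l)" unfolding fg[symmetric] split by (simp add: L_def g_zero)
    then have "?s\<^sup>2 \<le> F * (\<Sum>l\<in>L. (g l)\<^sup>2)" unfolding F_def by (simp add: Cauchy_Schwarz_ineq_sum)
    also have "(\<Sum>l\<in>L. (g l)\<^sup>2) = real n" unfolding gg[symmetric] split by (simp add: L_def g_zero)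
    finally show ?thesis .
  qed
  \<comment> \<open>Off \<open>L\<close> every weight is at least \<open>lambda_param A p\<close>;
    on \<open>L\<close> it is \<open>poly p r\<close>. For \<open>n = 1\<close> nothing lies off
    \<open>L\<close>, so the unspecified \<open>Min {}\<close> does no harm.\<close>
  have "?lam * (?s - F) + poly p r * F \<le> (\<Sum>l<n. poly p (d l) * (f l)\<^sup>2)"
  proof -
    have "?lam * (?s - F) = (\<Sum>l\<in>{..<n} - L. ?lam * (f l)\<^sup>2)"
      unfolding ff[symmetric] split[of "\<lambda>l. (f l)\<^sup>2"] F_def by (simp add: sum_distrib_left)
    also have "\<dots> \<le> (\<Sum>l\<in>{..<n} - L. poly p (d l) * (f l)\<^sup>2)"
      by (intro sum_mono mult_right_mono) (auto simp: L_def intro!: desc(2))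
    finally show ?thesis
      unfolding split[of "\<lambda>l. poly p (d l) * (f l)\<^sup>2"] by (simp add: F_def L_def sum_distrib_left)
  qed
  also have "\<dots> = (\<Sum>i\<in>S. \<Sum>j\<in>S. poly_mat p A $$ (i, j))"
    unfolding f_def power2_eq_square double
    by (intro sum.cong refl poly_mat_eigenbasis[OF A sym row_orth eigen, symmetric]) (use S in auto)
  also have "\<dots> = (\<Sum>i\<in>S. \<Sum>j\<in>S. if j = i then poly_mat p A $$ (i, i) else 0)"
    by (intro sum.cong refl) (auto simp: indep)
  also have "\<dots> = (\<Sum>i\<in>S. poly_mat p A $$ (i, i))" using fin by simp
  also have "\<dots> \<le> (\<Sum>i\<in>S. ?W)"
    by (intro sum_mono) (use S A in \<open>auto simp: W_param_def intro!: Max_ge\<close>)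
  finally have main: "(poly p r - ?lam) * F \<le> ?s * (?W - ?lam)" by (simp add: algebra_simps)
  \<comment> \<open>The positive gap allows \<open>F\<close> to be eliminated between the two
    estimates; one factor \<open>card S\<close> then cancels because \<open>S\<close> is
    nonempty.\<close>
  have "(poly p r - ?lam) * ?s\<^sup>2 \<le> (poly p r - ?lam) * (F * real n)"
    using gap desc(1) \<open>?s\<^sup>2 \<le> F * real n\<close> by (intro mult_left_mono) auto
  also have "\<dots> \<le> ?s * (?W - ?lam) * real n"
    using main by (simp add: mult_right_mono flip: mult.assoc)
  finally have "?s * (?s * (poly p r - ?lam)) \<le> ?s * (real n * (?W - ?lam))"
    by (simp add: power2_eq_square mult_ac)
  moreover have "?s > 0" using fin S by (simp add: card_gt_0_iff)
  ultimately show ?thesis by (simp only: mult_le_cancel_left_pos desc(1))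
qed

section \<open>Adjacency matrices and walks\<close>

lemma adjacency_matrix_carrier:
  "adjacency_matrix G vs \<in> carrier_mat (length vs) (length vs)"
  by (simp add: adjacency_matrix_def)

lemma (in sym_digraph) adjacency_matrix_transpose:
  "(adjacency_matrix G vs)\<^sup>T = adjacency_matrix G vs"
  by (rule eq_matI) (auto simp: adjacency_matrix_def dest: arcs_ends_symmetric[OF sym_arcs])

text \<open>Without parallel arcs, an arc leaving \<open>u\<close> is determined by its
  head.\<close>

lemma (in digraph) card_dominated:
  "card {v \<in> verts G. u \<rightarrow>\<^bsub>G\<^esub> v} = out_degree G u"
proof -
  have "inj_on (head G) (out_arcs G u)"
    by (auto simp: inj_on_def arc_to_ends_def intro: no_multi_arcs)
  moreover have "head G ` out_arcs G u = {v \<in> verts G. u \<rightarrow>\<^bsub>G\<^esub> v}"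
    by (auto simp: arcs_ends_def arc_to_ends_def image_def)
  ultimately show ?thesis unfolding out_degree_def by (metis card_image)
qed

lemma (in digraph) adjacency_matrix_row_sum:
  assumes vs: "distinct vs" "set vs = verts G" and i: "i < length vs"
  shows "(\<Sum>j<length vs. adjacency_matrix G vs $$ (i, j)) = real (out_degree G (vs ! i))"
proof -
  have "(\<Sum>j<length vs. adjacency_matrix G vs $$ (i, j))
    = (\<Sum>j<length vs. of_bool (vs ! i \<rightarrow>\<^bsub>G\<^esub> vs ! j))"
    using i by (intro sum.cong) (auto simp: adjacency_matrix_def)
  also have "\<dots> = (\<Sum>v\<in>verts G. of_bool (vs ! i \<rightarrow>\<^bsub>G\<^esub> v))"
    by (rule sum.reindex_bij_betw[OF bij_betw_nth]) (use vs in auto)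
  also have "\<dots> = real (card {v \<in> verts G. vs ! i \<rightarrow>\<^bsub>G\<^esub> v})"
    by (simp add: sum_of_bool_eq Int_def)
  finally show ?thesis by (simp add: card_dominated)
qed

text \<open>A nonzero entry of a product needs a nonzero summand, which splits off the last arc of
  the walk.\<close>

lemma (in wf_digraph) adjacency_matrix_pow_walk:
  assumes vs: "set vs = verts G" and i: "i < length vs" and j: "j < length vs"
    and "(adjacency_matrix G vs ^\<^sub>m k) $$ (i, j) \<noteq> 0"
  shows "\<exists>p. awalk (vs ! i) p (vs ! j) \<and> length p = k"
  using j assms(4)
proof (induction k arbitrary: j)
  case 0
  then have "i = j" using i by (auto simp: adjacency_matrix_def split: if_splits)
  then show ?case using vs i by (auto simp: awalk_Nil_iff intro: nth_mem)
next
  case (Suc k)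
  let ?A = "adjacency_matrix G vs"
  have A: "?A \<in> carrier_mat (length vs) (length vs)" by (rule adjacency_matrix_carrier)
  have "(\<Sum>m<length vs. (?A ^\<^sub>m k) $$ (i, m) * ?A $$ (m, j)) = (?A ^\<^sub>m Suc k) $$ (i, j)"
    using A pow_carrier_mat[OF A, of k] i Suc.prems(1) by (simp add: scalar_prod_def lessThan_atLeast0)
  with Suc.prems(2) obtain m where m: "m < length vs" "(?A ^\<^sub>m k) $$ (i, m) \<noteq> 0" "?A $$ (m, j) \<noteq> 0"
    by (metis (no_types, lifting) lessThan_iff mult_zero_left mult_zero_right sum.neutral)
  from Suc.IH[OF m(1,2)] obtain q where q: "awalk (vs ! i) q (vs ! m)" "length q = k" by blast
  have "vs ! m \<rightarrow>\<^bsub>G\<^esub> vs ! j"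
    using m Suc.prems(1) by (auto simp: adjacency_matrix_def split: if_splits)
  then obtain e where "e \<in> arcs G" "tail G e = vs ! m" "head G e = vs ! j"
    by (auto simp: arcs_ends_def arc_to_ends_def)
  then have "awalk (vs ! m) [e] (vs ! j)" using arc_implies_awalk by force
  with q have "awalk (vs ! i) (q @ [e]) (vs ! j)" by (blast intro: awalk_appendI)
  with q(2) show ?case by (intro exI[of _ "q @ [e]"]) simp
qed

lemma (in wf_digraph) geodist_le_walk_length:
  assumes "awalk u p v"
  shows "geodist G u v \<le> ereal (real (length p))"
  using min_cost_le_walk_cost[OF assms, of "\<lambda>_. 1"]
  by (simp add: geodist_def awalk_cost_def sum_list_triv)

lemma (in wf_digraph) poly_mat_adjacency_far:
  assumes vs: "set vs = verts G" and ij: "i < length vs" "j < length vs"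
    and far: "geodist G (vs ! i) (vs ! j) > ereal (real t)" and deg: "degree p \<le> t"
  shows "poly_mat p (adjacency_matrix G vs) $$ (i, j) = 0"
proof -
  have "(adjacency_matrix G vs ^\<^sub>m k) $$ (i, j) = 0" if "k \<le> degree p" for k
  proof (rule ccontr)
    assume "(adjacency_matrix G vs ^\<^sub>m k) $$ (i, j) \<noteq> 0"
    from adjacency_matrix_pow_walk[OF vs ij this] geodist_le_walk_length
    have "geodist G (vs ! i) (vs ! j) \<le> ereal (real k)" by blast
    also have "\<dots> \<le> ereal (real t)" using that deg by simp
    finally show False using far by simp
  qed
  then show ?thesis using ij by (simp add: poly_mat_def adjacency_matrix_def)
qed

section \<open>From class sizes to the number of colors\<close>

text \<open>An injection into the naturals is a valid coloring, so the \<open>LEAST\<close> ranges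
  over a nonempty set and is attained.\<close>

lemma optimal_distance_coloring:
  assumes "finite (verts G)"
  obtains c :: "'a \<Rightarrow> nat" where "distance_coloring G t c"
    and "card (c ` verts G) = distance_chromatic_number G t"
proof -
  obtain f :: "'a \<Rightarrow> nat" where "inj_on f (verts G)"
    using finite_imp_inj_to_nat_seg[OF assms] by blast
  then have "distance_coloring G t f" by (auto simp: distance_coloring_def inj_on_def)
  then have "\<exists>k. \<exists>c :: 'a \<Rightarrow> nat. distance_coloring G t c \<and> card (c ` verts G) = k" by blast
  from LeastI_ex[OF this] show thesis using that unfolding distance_chromatic_number_def by blast
qed

theorem theorem2p2:
  fixes G :: "('a, 'b) pre_digraph" and vs :: "'a list" and A :: "real mat"
    and p :: "real poly" and n t :: nat
  assumes "regular_graph G"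
    and "n = card (verts G)"
    and "distinct vs" and "set vs = verts G"
    and "A = adjacency_matrix G vs"
    and "t > 0"
    and "degree p \<le> t"
    and "poly p (eigenvalue_desc A 1) > lambda_param A p"
  shows "real (distance_chromatic_number G t) \<ge>
    real n / real_of_int \<lfloor>real n * ((W_param A p - lambda_param A p) /
      (poly p (eigenvalue_desc A 1) - lambda_param A p))\<rfloor>"
proof (cases "n = 0")
  case False
  interpret graph G using assms(1) by (simp add: regular_graph_def)
  obtain d where d: "\<And>v. v \<in> verts G \<Longrightarrow> out_degree G v = d"
    using assms(1) unfolding regular_graph_def by blast
  have len: "length vs = n" using assms(2-4) distinct_card by fastforce
  have A: "A \<in> carrier_mat n n" using adjacency_matrix_carrier[of G vs] by (simp add: assms(5) len)
  obtain c :: "'a \<Rightarrow> nat" where c: "distance_coloring G t c"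
    and card_c: "card (c ` verts G) = distance_chromatic_number G t"
    using optimal_distance_coloring[OF finite_verts] by blast
  define q where "q = real n * ((W_param A p - lambda_param A p) /
      (poly p (eigenvalue_desc A 1) - lambda_param A p))"
  \<comment> \<open>Color classes are taken as sets of matrix indices. Their sizes are integers, so
    the real bound \<open>q\<close> may be rounded down.\<close>
  have class_le: "int (card S) \<le> \<lfloor>q\<rfloor>"
    if S: "S = {i \<in> {..<n}. c (vs ! i) = x}" "S \<noteq> {}" for S x
  proof -
    have "real (card S) * (poly p (eigenvalue_desc A 1) - lambda_param A p)
      \<le> real n * (W_param A p - lambda_param A p)"
    proof (rule ratio_bound[OF A])
      show "A\<^sup>T = A" by (simp add: assms(5) adjacency_matrix_transpose)
      show "A $$ (i, j) \<ge> 0" if "i < n" "j < n" for i j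
        using that by (simp add: assms(5) adjacency_matrix_def len)
      show "(\<Sum>j<n. A $$ (i, j)) = real d" if "i < n" for i
        using adjacency_matrix_row_sum[OF assms(3,4), of i] that d[of "vs ! i"] nth_mem[of i vs]
        by (simp add: len assms(4,5))
      show "poly_mat p A $$ (i, j) = 0" if ij: "i \<in> S" "j \<in> S" "i \<noteq> j" for i j
      proof -
        have "vs ! i \<in> verts G" "vs ! j \<in> verts G" "vs ! i \<noteq> vs ! j"
          using ij S assms(3,4) len nth_mem[of _ vs] by (auto simp: nth_eq_iff_index_eq)
        moreover have "c (vs ! i) = c (vs ! j)" using ij S by simp
        ultimately have "geodist G (vs ! i) (vs ! j) > ereal (real t)"
          using c unfolding distance_coloring_def by (metis not_le)
        then show ?thesis
          using poly_mat_adjacency_far[OF assms(4), of i j t p] ij S assms(5,7) len by simp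
      qed
    qed (use S assms(8) in auto)
    then have "real (card S) \<le> q" using assms(8) by (simp add: q_def pos_le_divide_eq)
    then show ?thesis by (simp add: le_floor_iff)
  qed
  have "{..<n} = (\<Union>x\<in>c ` verts G. {i \<in> {..<n}. c (vs ! i) = x})"
    using len assms(4) nth_mem[of _ vs] by auto
  then have "int n = int (card (\<Union>x\<in>c ` verts G. {i \<in> {..<n}. c (vs ! i) = x}))"
    by (metis card_lessThan)
  also have "\<dots> \<le> (\<Sum>x\<in>c ` verts G. int (card {i \<in> {..<n}. c (vs ! i) = x}))"
    using card_UN_le[of "c ` verts G" "\<lambda>x. {i \<in> {..<n}. c (vs ! i) = x}"]
    by (simp flip: of_nat_sum)
  also have "\<dots> \<le> (\<Sum>x\<in>c ` verts G. \<lfloor>q\<rfloor>)"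
  proof (rule sum_mono)
    \<comment> \<open>Only colors that occur are summed over, so each class is nonempty as
      \<open>class_le\<close> requires.\<close>
    fix x assume "x \<in> c ` verts G"
    then obtain i where "i < n" "c (vs ! i) = x"
      using len assms(4) by (metis (no_types, lifting) imageE in_set_conv_nth)
    then show "int (card {i \<in> {..<n}. c (vs ! i) = x}) \<le> \<lfloor>q\<rfloor>" by (intro class_le[OF refl]) auto
  qed
  also have "\<dots> = int (distance_chromatic_number G t) * \<lfloor>q\<rfloor>" by (simp add: card_c)
  finally have bound: "int n \<le> int (distance_chromatic_number G t) * \<lfloor>q\<rfloor>" .
  \<comment> \<open>A nonpositive floor would make the product nonpositive, against
    \<open>n > 0\<close>; positivity makes the final division legitimate.\<close>
  then have "\<lfloor>q\<rfloor> > 0" using False by (metis linorder_not_le mult_nonneg_nonpos of_nat_0_le_iff of_nat_le_0_iff order_trans)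
  moreover have "real n \<le> real (distance_chromatic_number G t) * real_of_int \<lfloor>q\<rfloor>"
    using bound by (metis of_int_le_iff of_int_mult of_int_of_nat_eq)
  ultimately show ?thesis unfolding q_def by (simp add: pos_divide_le_eq)
\<comment> \<open>For \<open>n = 0\<close> the quotient is 0, whatever its denominator.\<close>
qed simp

end
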